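(* Let $a\ge0$ and, for $\#\in\{\mathrm{ET},\mathrm{ST}\}$, let $$b^{\mathrm p}_{\#}(\hat p,t;a)=\int_0^t e^{\frac{\sqrt\mu}{4}\zeta}\,b^{\mathrm d}_{\#}(\hat p,\zeta;a)\,d\zeta .$$ Let $\hat p=[\hat x,\hat v]^T\in\mathbb{R}^n\times\mathbb{R}^n$ and let $t\mapsto p(t)=\hat p+tX^a_{\mathrm{hb}}(\hat p)$ be the trajectory of the zero-order hold dynamics $\dot p=X^a_{\mathrm{hb}}(\hat p)$, $p(0)=\hat p$. Then, for all $t\ge0$, $$V(p(t))-e^{-\frac{\sqrt\mu}{4}t}V(\hat p)\le e^{-\frac{\sqrt\mu}{4}t}\,b^{\mathrm p}_{\mathrm{ET}}(\hat p,t;a)\le e^{-\frac{\sqrt\mu}{4}t}\,b^{\mathrm p}_{\mathrm{ST}}(\hat p,t;a).$$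
   Context: Let $\mu,L,s>0$, and let $f:\mathbb{R}^n\to\mathbb{R}$ be continuously differentiable, $\mu$-strongly convex (i.e. $f(y)-f(x)\ge\langle\nabla f(x),y-x\rangle+\frac{\mu}{2}\|x-y\|^2$ for all $x,y$), with $L$-Lipschitz gradient; $x_*$ is its unique minimizer. Norms are Euclidean. Notation: $\sqrt{\mu_s}=1+\sqrt{\mu s}$, so $\mu_s=(1+\sqrt{\mu s})^2$. For $a\ge0$, $$X^a_{\mathrm{hb}}(x,v)=\begin{bmatrix} v\\ -2\sqrt{\mu}\,v-\sqrt{\mu_s}\,\nabla f(x+av)\end{bmatrix},$$ $$V(x,v)=\sqrt{\mu_s}\,(f(x)-f(x_* ))+\tfrac14\|v\|^2+\tfrac14\|v+2\sqrt{\mu}(x-x_* )\|^2 .$$ For $\hat p=[\hat x,\hat v]^T$ write $\hat g=\nabla f(\hat x+a\hat v)$ and define $$b^{\mathrm d}_{\mathrm{ET}}(\hat p,t;a)=A_{\mathrm{ET}}(\hat p,t;a)+B_{\mathrm{ET}}(\hat p,t;a)+C_{\mathrm{ET}}(\hat p;a),$$ $$b^{\mathrm d}_{\mathrm{ST}}(\hat p,t;a)=B^q_{\mathrm{ST}}(\hat p;a)t^2+(A_{\mathrm{ST}}(\hat p;a)+B^l_{\mathrm{ST}}(\hat p;a))t+C_{\mathrm{ST}}(\hat p;a),$$ where $$A_{\mathrm{ET}}(\hat p,t;a)=2\mu t\|\hat v\|^2+\sqrt{\mu_s}\big(\langle\nabla f(\hat x+t\hat v)-\nabla f(\hat x),\hat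 v\rangle+2t\sqrt\mu\langle\hat g,\hat v\rangle+t\sqrt{\mu_s}\|\hat g\|^2\big),$$ $$B_{\mathrm{ET}}(\hat p,t;a)=\frac{\sqrt\mu t^2}{16}\|2\sqrt\mu\hat v+\sqrt{\mu_s}\hat g\|^2-\frac{t\mu}{4}\|\hat v\|^2+\frac{\sqrt\mu\sqrt{\mu_s}}{4}\Big(f(\hat x+t\hat v)-f(\hat x)-t\langle\hat v,\hat g\rangle+\frac{t^2\sqrt{\mu_s}}{4}\|\hat g\|^2-\frac{t\sqrt\mu}{L}\|\hat g\|^2+t\sqrt\mu\langle a\hat v,\hat g\rangle\Big),$$ $$C_{\mathrm{ET}}(\hat p;a)=-\frac{13\sqrt\mu}{16}\|\hat v\|^2-\frac{\mu^2\sqrt s}{2}\frac{\|\nabla f(\hat x)\|^2}{L^2}+\sqrt{\mu_s}\Big(-\frac{3\sqrt\mu}{8L}\|\nabla f(\hat x)\|^2+\sqrt\mu(f(\hat x)-f(\hat x+a\hat v))+\sqrt\mu\|\nabla f(\hat x)\|\|a\hat v\|-\frac{\mu^{3/2}}{2}\|a\hat v\|^2-\langle\hat g-\nabla f(\hat x),\hat v\rangle+\sqrt\mu\langle\hat g,a\hat v\rangle\Big),$$ $$A_{\mathrm{ST}}(\hat p;a)=2\mu\|\hat v\|^2+\sqrt{\mu_s}\big(L\|\hat v\|^2+2\sqrt\mu\langle\hat g,\hat v\rangle+\sqrt{\mu_s}\|\hat g\|^2\big),$$ $$B^l_{\mathrm{ST}}(\hat p;a)=\frac{\sqrt\mu}{4}\Big(-\sqrt\mu\|\hat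 v\|^2+\sqrt{\mu_s}\big(\langle\nabla f(\hat x)-\hat g,\hat v\rangle-\frac{\sqrt\mu}{L}\|\hat g\|^2+\sqrt\mu\langle a\hat v,\hat g\rangle\big)\Big),$$ $$B^q_{\mathrm{ST}}(\hat p;a)=\frac{\sqrt\mu}{16}\|2\sqrt\mu\hat v+\sqrt{\mu_s}\hat g\|^2+\frac{\sqrt\mu\sqrt{\mu_s}}{4}\Big(\frac L2\|\hat v\|^2+\frac{\sqrt{\mu_s}}{4}\|\hat g\|^2\Big),$$ $$C_{\mathrm{ST}}(\hat p;a)=C_{\mathrm{ET}}(\hat p;a).$$ *)

theory Defs
  imports "HOL-Analysis.Analysis"
begin

(* The library's GDERIV f x :> D says that D is the gradient of f at x;
   by grad_eqI and GDERIV_grad below, grad f x is that vector whenever f is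
   differentiable at x, and it is unspecified otherwise. *)
definition grad :: "('a::euclidean_space \<Rightarrow> real) \<Rightarrow> 'a \<Rightarrow> 'a" where
  "grad f x = (THE D. GDERIV f x :> D)"

lemma grad_eqI:
  assumes "GDERIV f x :> D"
  shows "grad f x = D"
  unfolding grad_def
proof (rule the_equality)
  show "GDERIV f x :> D" by (rule assms)
next
  fix E assume E: "GDERIV f x :> E"
  have "(\<lambda>h. h \<bullet> E) = (\<lambda>h. h \<bullet> D)"
    by (rule has_derivative_unique[OF E[unfolded gderiv_def] assms[unfolded gderiv_def]])
  then have "h \<bullet> E = h \<bullet> D" for h
    by (rule fun_cong)
  then show "E = D"
    using vector_eq_ldot by blast
qed

lemma GDERIV_grad:
  assumes "f differentiable (at x)"
  shows "GDERIV f x :> grad f x"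
proof -
  from assms obtain f' where f': "(f has_derivative f') (at x)"
    unfolding differentiable_def by blast
  define D where "D = adjoint f' 1"
  from has_derivative_linear[OF f'] have "f' h = h \<bullet> D" for h
    using adjoint_works[of f' h 1] by (simp add: D_def)
  then have "f' = (\<lambda>h. h \<bullet> D)"
    by (rule ext)
  with f' have "GDERIV f x :> D"
    by (simp only: gderiv_def)
  with grad_eqI[OF this] show ?thesis
    by (simp only:)
qed

definition C1 :: "('a::euclidean_space \<Rightarrow> real) \<Rightarrow> bool" where
  "C1 f \<longleftrightarrow> (\<forall>x. f differentiable (at x)) \<and> continuous_on UNIV (grad f)"

definition strongly_convex :: "real \<Rightarrow> ('a::euclidean_space \<Rightarrow> real) \<Rightarrow> bool" where
  "strongly_convex \<mu> f \<longleftrightarrow>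
     (\<forall>x y. f y - f x \<ge> grad f x \<bullet> (y - x) + \<mu> / 2 * (norm (x - y))\<^sup>2)"

(* The square root of mu_s = (1 + sqrt (mu s))^2. *)
definition rmus :: "real \<Rightarrow> real \<Rightarrow> real" where
  "rmus \<mu> s = 1 + sqrt (\<mu> * s)"

definition X_hb :: "('a::euclidean_space \<Rightarrow> real) \<Rightarrow> real \<Rightarrow> real \<Rightarrow> real \<Rightarrow> 'a \<times> 'a \<Rightarrow> 'a \<times> 'a" where
  "X_hb f \<mu> s a = (\<lambda>(x, v).
     (v, - (2 * sqrt \<mu>) *\<^sub>R v - rmus \<mu> s *\<^sub>R grad f (x + a *\<^sub>R v)))"

definition V_hb :: "('a::euclidean_space \<Rightarrow> real) \<Rightarrow> real \<Rightarrow> real \<Rightarrow> 'a \<Rightarrow> 'a \<times> 'a \<Rightarrow> real" where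
  "V_hb f \<mu> s xstar = (\<lambda>(x, v).
     rmus \<mu> s * (f x - f xstar) + 1/4 * (norm v)\<^sup>2
       + 1/4 * (norm (v + (2 * sqrt \<mu>) *\<^sub>R (x - xstar)))\<^sup>2)"

definition zoh :: "('a::euclidean_space \<Rightarrow> real) \<Rightarrow> real \<Rightarrow> real \<Rightarrow> real \<Rightarrow> 'a \<times> 'a \<Rightarrow> real \<Rightarrow> 'a \<times> 'a" where
  "zoh f \<mu> s a p t = p + t *\<^sub>R X_hb f \<mu> s a p"

lemma zoh_0: "zoh f \<mu> s a p 0 = p"
  by (simp add: zoh_def)

lemma zoh_vector_derivative:
  "(zoh f \<mu> s a p has_vector_derivative X_hb f \<mu> s a p) (at t within T)"
  unfolding zoh_def by (auto intro!: derivative_eq_intros)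

definition A_ET :: "('a::euclidean_space \<Rightarrow> real) \<Rightarrow> real \<Rightarrow> real \<Rightarrow> real \<Rightarrow> 'a \<times> 'a \<Rightarrow> real \<Rightarrow> real" where
  "A_ET f \<mu> s a = (\<lambda>(x, v) t. let g = grad f (x + a *\<^sub>R v) in
     2 * \<mu> * t * (norm v)\<^sup>2
     + rmus \<mu> s * ((grad f (x + t *\<^sub>R v) - grad f x) \<bullet> v
         + 2 * t * sqrt \<mu> * (g \<bullet> v) + t * rmus \<mu> s * (norm g)\<^sup>2))"

definition B_ET :: "('a::euclidean_space \<Rightarrow> real) \<Rightarrow> real \<Rightarrow> real \<Rightarrow> real \<Rightarrow> real \<Rightarrow> 'a \<times> 'a \<Rightarrow> real \<Rightarrow> real" where
  "B_ET f \<mu> L s a = (\<lambda>(x, v) t. let g = grad f (x + a *\<^sub>R v) in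
     sqrt \<mu> * t\<^sup>2 / 16 * (norm ((2 * sqrt \<mu>) *\<^sub>R v + rmus \<mu> s *\<^sub>R g))\<^sup>2
     - t * \<mu> / 4 * (norm v)\<^sup>2
     + sqrt \<mu> * rmus \<mu> s / 4 *
         (f (x + t *\<^sub>R v) - f x - t * (v \<bullet> g) + t\<^sup>2 * rmus \<mu> s / 4 * (norm g)\<^sup>2
          - t * sqrt \<mu> / L * (norm g)\<^sup>2 + t * sqrt \<mu> * ((a *\<^sub>R v) \<bullet> g)))"

definition C_ET :: "('a::euclidean_space \<Rightarrow> real) \<Rightarrow> real \<Rightarrow> real \<Rightarrow> real \<Rightarrow> real \<Rightarrow> 'a \<times> 'a \<Rightarrow> real" where
  "C_ET f \<mu> L s a = (\<lambda>(x, v). let g = grad f (x + a *\<^sub>R v) in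
     - (13 * sqrt \<mu> / 16 * (norm v)\<^sup>2)
     - \<mu>\<^sup>2 * sqrt s / 2 * ((norm (grad f x))\<^sup>2 / L\<^sup>2)
     + rmus \<mu> s *
         (- (3 * sqrt \<mu> / (8 * L) * (norm (grad f x))\<^sup>2)
          + sqrt \<mu> * (f x - f (x + a *\<^sub>R v))
          + sqrt \<mu> * norm (grad f x) * norm (a *\<^sub>R v)
          - \<mu> powr (3/2) / 2 * (norm (a *\<^sub>R v))\<^sup>2
          - (g - grad f x) \<bullet> v
          + sqrt \<mu> * (g \<bullet> (a *\<^sub>R v))))"

definition A_ST :: "('a::euclidean_space \<Rightarrow> real) \<Rightarrow> real \<Rightarrow> real \<Rightarrow> real \<Rightarrow> real \<Rightarrow> 'a \<times> 'a \<Rightarrow> real" where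
  "A_ST f \<mu> L s a = (\<lambda>(x, v). let g = grad f (x + a *\<^sub>R v) in
     2 * \<mu> * (norm v)\<^sup>2
     + rmus \<mu> s * (L * (norm v)\<^sup>2 + 2 * sqrt \<mu> * (g \<bullet> v) + rmus \<mu> s * (norm g)\<^sup>2))"

definition Bl_ST :: "('a::euclidean_space \<Rightarrow> real) \<Rightarrow> real \<Rightarrow> real \<Rightarrow> real \<Rightarrow> real \<Rightarrow> 'a \<times> 'a \<Rightarrow> real" where
  "Bl_ST f \<mu> L s a = (\<lambda>(x, v). let g = grad f (x + a *\<^sub>R v) in
     sqrt \<mu> / 4 *
       (- (sqrt \<mu> * (norm v)\<^sup>2)
        + rmus \<mu> s * ((grad f x - g) \<bullet> v - sqrt \<mu> / L * (norm g)\<^sup>2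
                        + sqrt \<mu> * ((a *\<^sub>R v) \<bullet> g))))"

definition Bq_ST :: "('a::euclidean_space \<Rightarrow> real) \<Rightarrow> real \<Rightarrow> real \<Rightarrow> real \<Rightarrow> real \<Rightarrow> 'a \<times> 'a \<Rightarrow> real" where
  "Bq_ST f \<mu> L s a = (\<lambda>(x, v). let g = grad f (x + a *\<^sub>R v) in
     sqrt \<mu> / 16 * (norm ((2 * sqrt \<mu>) *\<^sub>R v + rmus \<mu> s *\<^sub>R g))\<^sup>2
     + sqrt \<mu> * rmus \<mu> s / 4 * (L / 2 * (norm v)\<^sup>2 + rmus \<mu> s / 4 * (norm g)\<^sup>2))"

definition C_ST :: "('a::euclidean_space \<Rightarrow> real) \<Rightarrow> real \<Rightarrow> real \<Rightarrow> real \<Rightarrow> real \<Rightarrow> 'a \<times> 'a \<Rightarrow> real" where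
  "C_ST = C_ET"

definition bd_ET :: "('a::euclidean_space \<Rightarrow> real) \<Rightarrow> real \<Rightarrow> real \<Rightarrow> real \<Rightarrow> real \<Rightarrow> 'a \<times> 'a \<Rightarrow> real \<Rightarrow> real" where
  "bd_ET f \<mu> L s a p t = A_ET f \<mu> s a p t + B_ET f \<mu> L s a p t + C_ET f \<mu> L s a p"

definition bd_ST :: "('a::euclidean_space \<Rightarrow> real) \<Rightarrow> real \<Rightarrow> real \<Rightarrow> real \<Rightarrow> real \<Rightarrow> 'a \<times> 'a \<Rightarrow> real \<Rightarrow> real" where
  "bd_ST f \<mu> L s a p t =
     Bq_ST f \<mu> L s a p * t\<^sup>2 + (A_ST f \<mu> L s a p + Bl_ST f \<mu> L s a p) * t + C_ST f \<mu> L s a p"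

definition bp_ET :: "('a::euclidean_space \<Rightarrow> real) \<Rightarrow> real \<Rightarrow> real \<Rightarrow> real \<Rightarrow> real \<Rightarrow> 'a \<times> 'a \<Rightarrow> real \<Rightarrow> real" where
  "bp_ET f \<mu> L s a p t = integral {0..t} (\<lambda>\<zeta>. exp (sqrt \<mu> / 4 * \<zeta>) * bd_ET f \<mu> L s a p \<zeta>)"

definition bp_ST :: "('a::euclidean_space \<Rightarrow> real) \<Rightarrow> real \<Rightarrow> real \<Rightarrow> real \<Rightarrow> real \<Rightarrow> 'a \<times> 'a \<Rightarrow> real \<Rightarrow> real" where
  "bp_ST f \<mu> L s a p t = integral {0..t} (\<lambda>\<zeta>. exp (sqrt \<mu> / 4 * \<zeta>) * bd_ST f \<mu> L s a p \<zeta>)"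

(* The two integrands are continuous, so the integrals above exist and are not
   the library's default value 0 for non-integrable functions. *)
lemma bp_integrable:
  assumes "C1 f"
  shows "(\<lambda>\<zeta>. exp (sqrt \<mu> / 4 * \<zeta>) * bd_ET f \<mu> L s a p \<zeta>) integrable_on {0..t}"
    and "(\<lambda>\<zeta>. exp (sqrt \<mu> / 4 * \<zeta>) * bd_ST f \<mu> L s a p \<zeta>) integrable_on {0..t}"
proof -
  obtain x v where p: "p = (x, v)" by force
  have f: "continuous_on UNIV f" and g: "continuous_on UNIV (grad f)"
    using assms unfolding C1_def
    by (auto simp: continuous_on_eq_continuous_within intro!: differentiable_imp_continuous_within)
  have [continuous_intros]: "continuous_on {0..t} (\<lambda>\<zeta>. f (x + \<zeta> *\<^sub>R v))"
    by (rule continuous_on_compose2[OF f]) (intro continuous_intros, simp)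
  have [continuous_intros]: "continuous_on {0..t} (\<lambda>\<zeta>. grad f (x + \<zeta> *\<^sub>R v))"
    by (rule continuous_on_compose2[OF g]) (intro continuous_intros, simp)
  show "(\<lambda>\<zeta>. exp (sqrt \<mu> / 4 * \<zeta>) * bd_ET f \<mu> L s a p \<zeta>) integrable_on {0..t}"
    unfolding bd_ET_def A_ET_def B_ET_def p Let_def divide_inverse prod.case
    by (intro integrable_continuous_real continuous_intros)
  show "(\<lambda>\<zeta>. exp (sqrt \<mu> / 4 * \<zeta>) * bd_ST f \<mu> L s a p \<zeta>) integrable_on {0..t}"
    unfolding bd_ST_def
    by (intro integrable_continuous_real continuous_intros)
qed

end

(* Along the zero-order hold trajectory, V satisfies the differential inequality
   V' + sqrt mu / 4 * V <= bd_ET; multiplying by the integrating factor exp (sqrt mu / 4 * t)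
   and integrating gives the first bound. In V' + sqrt mu / 4 * V everything is explicit
   except for the terms involving xstar. These are eliminated through cocoercivity of the gradient
   (the terms linear in t), and through strong convexity between x + a v and xstar together with
   |grad f x|^2 / (2 L) <= f x - f xstar and mu |x - xstar| <= |grad f x| <= L |x - xstar|
   (the constant terms). The second bound is pointwise: it replaces the increments
   of grad f and f along v by their Lipschitz and descent-lemma majorants. *)

theory Submission
  imports Defs
begin

section \<open>Derivatives along lines\<close>

lemma C1_has_field_derivative_along_line:
  assumes "C1 f"
  shows "((\<lambda>t. f (x + t *\<^sub>R d)) has_field_derivative grad f (x + t *\<^sub>R d) \<bullet> d) (at t within T)"
proof -
  have "GDERIV f (x + t *\<^sub>R d) :> grad f (x + t *\<^sub>R d)"
    using assms by (intro GDERIV_grad) (simp add: C1_def)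
  then have "(f has_derivative (\<lambda>h. h \<bullet> grad f (x + t *\<^sub>R d))) (at (x + t *\<^sub>R d))"
    by (simp add: gderiv_def)
  moreover have "((\<lambda>t. x + t *\<^sub>R d) has_derivative (\<lambda>h. h *\<^sub>R d)) (at t within T)"
    by (auto intro!: derivative_eq_intros)
  ultimately have "((\<lambda>t. f (x + t *\<^sub>R d)) has_derivative
      (\<lambda>h. (h *\<^sub>R d) \<bullet> grad f (x + t *\<^sub>R d))) (at t within T)"
    by (rule has_derivative_compose[rotated])
  then show ?thesis
    by (simp add: has_field_derivative_def inner_commute mult_commute_abs)
qed

lemma norm_line_power2_has_field_derivative:
  fixes x d :: "'a::real_inner"
  shows "((\<lambda>t. (norm (x + t *\<^sub>R d))\<^sup>2) has_field_derivative 2 * ((x + t *\<^sub>R d) \<bullet> d)) (at t within T)"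
proof -
  have "(norm (x + t *\<^sub>R d))\<^sup>2 = x \<bullet> x + 2 * t * (x \<bullet> d) + t\<^sup>2 * (d \<bullet> d)" for t
    unfolding power2_norm_eq_inner
    by (simp add: inner_commute algebra_simps power2_eq_square)
  then show ?thesis
    by (auto intro!: derivative_eq_intros simp: algebra_simps)
qed

lemma grad_eq_0_at_minimum:
  assumes "C1 f" "\<And>y. f z \<le> f y"
  shows "grad f z = 0"
proof -
  \<comment> \<open>Along this direction the derivative of \<open>f\<close> at \<open>z\<close> is
    the squared norm of the gradient.\<close>
  let ?d = "grad f z"
  have "((\<lambda>t. f (z + t *\<^sub>R ?d)) has_field_derivative grad f (z + 0 *\<^sub>R ?d) \<bullet> ?d) (at 0)"
    by (rule C1_has_field_derivative_along_line[OF assms(1)])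
  then have "grad f (z + 0 *\<^sub>R ?d) \<bullet> ?d = 0"
    by (rule DERIV_local_min[where d = 1]) (auto simp: assms(2))
  then show ?thesis by simp
qed

section \<open>Consequences of a Lipschitz gradient\<close>

lemma lipschitz_grad_inner_le:
  assumes "L-lipschitz_on UNIV (grad f)"
  shows "(grad f (x + d) - grad f x) \<bullet> d \<le> L * (norm d)\<^sup>2"
proof -
  have "(grad f (x + d) - grad f x) \<bullet> d \<le> norm (grad f (x + d) - grad f x) * norm d"
    by (rule norm_cauchy_schwarz)
  also have "\<dots> \<le> (L * norm d) * norm d"
    using lipschitz_onD[OF assms, of "x + d" x] by (intro mult_right_mono) (simp_all add: dist_norm)
  finally show ?thesis by (simp add: power2_eq_square mult.assoc)
qed

lemma lipschitz_grad_inner_scaleR_le: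
  assumes "L-lipschitz_on UNIV (grad f)" "t \<ge> 0"
  shows "(grad f (x + t *\<^sub>R d) - grad f x) \<bullet> d \<le> L * t * (norm d)\<^sup>2"
proof (cases "t = 0")
  case False
  then have "t > 0" using assms(2) by simp
  \<comment> \<open>The displacement \<open>t d\<close> yields one factor \<open>t\<close> too many
    on both sides; it is cancelled afterwards.\<close>
  have "t * ((grad f (x + t *\<^sub>R d) - grad f x) \<bullet> d) \<le> t * (L * t * (norm d)\<^sup>2)"
    using lipschitz_grad_inner_le[OF assms(1), of x "t *\<^sub>R d"]
    by (simp add: power2_eq_square ac_simps)
  with \<open>t > 0\<close> show ?thesis by (simp only: mult_le_cancel_left_pos)
qed simp

text \<open>The difference of the two sides is nonincreasing in \<open>t\<close>, by the Lipschitz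
  bound on its derivative. Keeping \<open>t\<close> apart from \<open>d\<close> gives a majorant
  polynomial in \<open>t\<close>, as \<open>bd_ST\<close> requires.\<close>

lemma descent_lemma:
  assumes "C1 f" "L-lipschitz_on UNIV (grad f)" "t \<ge> 0"
  shows "f (x + t *\<^sub>R d) \<le> f x + t * (grad f x \<bullet> d) + L / 2 * t\<^sup>2 * (norm d)\<^sup>2"
proof -
  let ?\<phi> = "\<lambda>t. f (x + t *\<^sub>R d) - t * (grad f x \<bullet> d) - L / 2 * t\<^sup>2 * (norm d)\<^sup>2"
  have "?\<phi> t \<le> ?\<phi> 0"
  proof (rule DERIV_nonpos_imp_nonincreasing[OF assms(3)])
    fix u :: real assume u: "0 \<le> u" "u \<le> t"
    have "(?\<phi> has_field_derivative
        grad f (x + u *\<^sub>R d) \<bullet> d - grad f x \<bullet> d - L * u * (norm d)\<^sup>2) (at u)"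
      by (auto intro!: derivative_eq_intros C1_has_field_derivative_along_line[OF assms(1)])
    then show "\<exists>y. (?\<phi> has_field_derivative y) (at u) \<and> y \<le> 0"
      using lipschitz_grad_inner_scaleR_le[OF assms(2) u(1), of x d]
      by (auto simp: inner_diff_left)
  qed
  then show ?thesis by simp
qed

lemma convex_lipschitz_grad_lower_bound:
  assumes "C1 f" "L-lipschitz_on UNIV (grad f)" "L > 0"
    and convex: "\<And>w. f x + grad f x \<bullet> (w - x) \<le> f w"
  shows "f x + grad f x \<bullet> (y - x) + (norm (grad f y - grad f x))\<^sup>2 / (2 * L) \<le> f y"
proof -
  \<comment> \<open>A gradient step from \<open>y\<close> for \<open>f - grad f x \<bullet> _\<close>, which is minimal at \<open>x\<close>.\<close>
  define d where "d = grad f y - grad f x"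
  define w where "w = y + (1 / L) *\<^sub>R (- d)"
  have "f x + grad f x \<bullet> (w - x) \<le> f w" by (rule convex)
  also have "\<dots> \<le> f y + 1 / L * (grad f y \<bullet> (- d)) + L / 2 * (1 / L)\<^sup>2 * (norm (- d))\<^sup>2"
    unfolding w_def using assms by (intro descent_lemma) auto
  finally have "f x + grad f x \<bullet> (y - x) + (grad f y - grad f x) \<bullet> d / L
      \<le> f y + L / 2 * (1 / L)\<^sup>2 * (norm d)\<^sup>2"
    by (simp add: w_def inner_diff_left inner_diff_right diff_divide_distrib)
  moreover have "L / 2 * (1 / L)\<^sup>2 * (norm d)\<^sup>2 = (norm d)\<^sup>2 / (2 * L)"
    "(grad f y - grad f x) \<bullet> d / L = (norm d)\<^sup>2 / (2 * L) + (norm d)\<^sup>2 / (2 * L)"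
    using assms(3)
    by (simp_all add: d_def[symmetric] dot_square_norm power2_eq_square)
  ultimately show ?thesis unfolding d_def[symmetric] by linarith
qed

section \<open>Inequalities relating gradient, function gap and distance to the minimizer\<close>

locale smooth_strongly_convex =
  fixes f :: "'a::euclidean_space \<Rightarrow> real" and \<mu> L :: real and xstar :: 'a
  assumes mu_pos: "\<mu> > 0" and L_pos: "L > 0"
    and C1: "C1 f"
    and strongly_convex: "strongly_convex \<mu> f"
    and lipschitz_grad: "L-lipschitz_on UNIV (grad f)"
    and minimum: "f xstar \<le> f y"
begin

lemma strong_convexity:
  "f x + grad f x \<bullet> (y - x) + \<mu> / 2 * (norm (x - y))\<^sup>2 \<le> f y"
  using strongly_convex unfolding strongly_convex_def by (smt (verit))

lemma first_order_convexity: "f x + grad f x \<bullet> (y - x) \<le> f y"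
proof -
  have "0 \<le> \<mu> / 2 * (norm (x - y))\<^sup>2" using mu_pos by simp
  with strong_convexity[of x y] show ?thesis by linarith
qed

lemma grad_xstar: "grad f xstar = 0"
  using C1 minimum by (rule grad_eq_0_at_minimum)

lemma norm_grad_le: "norm (grad f x) \<le> L * norm (x - xstar)"
  using lipschitz_onD[OF lipschitz_grad, of x xstar] by (simp add: dist_norm grad_xstar)

text \<open>Adding strong convexity from \<open>x\<close> to \<open>xstar\<close> and back cancels
  the function values; Cauchy-Schwarz then allows division by the distance.\<close>

lemma norm_grad_ge: "\<mu> * norm (x - xstar) \<le> norm (grad f x)"
proof (cases "x = xstar")
  case False
  then have pos: "norm (x - xstar) > 0" by simp
  have "\<mu> * (norm (x - xstar))\<^sup>2 \<le> grad f x \<bullet> (x - xstar)"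
    using strong_convexity[of x xstar] strong_convexity[of xstar x]
    by (simp add: grad_xstar norm_minus_commute inner_diff_right)
  also have "\<dots> \<le> norm (grad f x) * norm (x - xstar)" by (rule norm_cauchy_schwarz)
  finally show ?thesis using pos by (simp add: power2_eq_square flip: mult.assoc)
qed simp

lemma gap_ge_norm_grad: "(norm (grad f x))\<^sup>2 / (2 * L) \<le> f x - f xstar"
  using convex_lipschitz_grad_lower_bound[OF C1 lipschitz_grad L_pos, of xstar x]
    minimum by (simp add: grad_xstar)

text \<open>The gradient lower bound is used in both directions between \<open>x\<close> and
  \<open>xstar\<close>; each contributes half of the left-hand side.\<close>

lemma cocoercive: "(norm (grad f x))\<^sup>2 / L \<le> grad f x \<bullet> (x - xstar)"
proof -
  have "f x + grad f x \<bullet> (xstar - x) + (norm (grad f x))\<^sup>2 / (2 * L) \<le> f xstar"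
    using convex_lipschitz_grad_lower_bound[OF C1 lipschitz_grad L_pos, of x xstar]
      first_order_convexity by (simp add: grad_xstar)
  moreover have "(norm (grad f x))\<^sup>2 / L = (norm (grad f x))\<^sup>2 / (2 * L) + (norm (grad f x))\<^sup>2 / (2 * L)"
    by simp
  ultimately show ?thesis using gap_ge_norm_grad[of x] by (simp add: inner_diff_right)
qed

section \<open>The Lyapunov function along the hold trajectory\<close>

text \<open>Both squared norms are taken along lines, the second with velocity \<open>- r g\<close>.
  Since \<open>A_ET\<close> vanishes at \<open>t = 0\<close>, the remaining terms are the derivative
  at time 0.\<close>

lemma V_hb_zoh_has_field_derivative:
  fixes x v :: 'a and s a :: real
  defines "k \<equiv> sqrt \<mu>" and "r \<equiv> rmus \<mu> s"
    and "g \<equiv> grad f (x + a *\<^sub>R v)"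
  shows "((\<lambda>t. V_hb f \<mu> s xstar (zoh f \<mu> s a (x, v) t)) has_field_derivative
    A_ET f \<mu> s a (x, v) t - k * (norm v)\<^sup>2 - r * ((g - grad f x) \<bullet> v)
      - r * k * (g \<bullet> (x - xstar))) (at t within T)"
proof -
  define u where "u = - (2 * k) *\<^sub>R v - r *\<^sub>R g"
  define y where "y = v + (2 * k) *\<^sub>R (x - xstar)"
  have kk: "k * k = \<mu>" using mu_pos by (simp add: k_def)
  have V: "V_hb f \<mu> s xstar (zoh f \<mu> s a (x, v) t) =
      r * (f (x + t *\<^sub>R v) - f xstar) + 1/4 * (norm (v + t *\<^sub>R u))\<^sup>2
       + 1/4 * (norm (y + t *\<^sub>R (u + (2 * k) *\<^sub>R v)))\<^sup>2" for t
    by (simp add: V_hb_def zoh_def X_hb_def u_def y_def k_def r_def g_def algebra_simps)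
  have V': "r * (grad f (x + t *\<^sub>R v) \<bullet> v) + 1/4 * (2 * ((v + t *\<^sub>R u) \<bullet> u))
       + 1/4 * (2 * ((y + t *\<^sub>R (u + (2 * k) *\<^sub>R v)) \<bullet> (u + (2 * k) *\<^sub>R v)))
     = A_ET f \<mu> s a (x, v) t - k * (norm v)\<^sup>2 - r * ((g - grad f x) \<bullet> v)
      - r * k * (g \<bullet> (x - xstar))"
    unfolding A_ET_def Let_def prod.case g_def[symmetric] r_def[symmetric] k_def[symmetric]
      power2_norm_eq_inner u_def y_def
    unfolding kk[symmetric]
    by (simp add: inner_commute algebra_simps)
  show ?thesis
    unfolding V V'[symmetric]
    by (rule norm_line_power2_has_field_derivative C1_has_field_derivative_along_line[OF C1]
        derivative_eq_intros refl | simp)+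
qed

text \<open>The last three summands are the value at \<open>t = 0\<close>. The increment contains
  \<open>g \<bullet> (x - xstar)\<close>, which \<open>B_ET\<close> replaces by the computable
  \<open>(norm g)^2 / L - g \<bullet> (a v)\<close>; the cocoercivity defect at
  \<open>x + a v\<close> records the difference.\<close>

lemma V_hb_zoh_eq:
  fixes x v :: 'a and s a :: real
  defines "k \<equiv> sqrt \<mu>" and "r \<equiv> rmus \<mu> s"
    and "g \<equiv> grad f (x + a *\<^sub>R v)"
  shows "k / 4 * V_hb f \<mu> s xstar (zoh f \<mu> s a (x, v) t) =
    B_ET f \<mu> L s a (x, v) t
    + k * r / 4 * (t * k) * ((norm g)\<^sup>2 / L - g \<bullet> (x + a *\<^sub>R v - xstar))
    + k * r / 4 * (f x - f xstar) + k / 16 * (norm v)\<^sup>2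
    + k / 16 * (norm (v + (2 * k) *\<^sub>R (x - xstar)))\<^sup>2"
proof -
  have kk: "k * k = \<mu>" using mu_pos by (simp add: k_def)
  show ?thesis
    unfolding V_hb_def zoh_def X_hb_def B_ET_def Let_def prod.case scaleR_Pair add_Pair
      g_def[symmetric] r_def[symmetric] k_def[symmetric] power2_norm_eq_inner
    unfolding kk[symmetric]
    by (simp add: inner_commute algebra_simps power2_eq_square add_divide_distrib diff_divide_distrib)
qed

lemma constant_terms_le_C_ET:
  fixes x v :: 'a and s a :: real
  assumes "s > 0"
  defines "k \<equiv> sqrt \<mu>" and "r \<equiv> rmus \<mu> s"
    and "g \<equiv> grad f (x + a *\<^sub>R v)"
  shows "k * r / 4 * (f x - f xstar) + k / 16 * (norm v)\<^sup>2
      + k / 16 * (norm (v + (2 * k) *\<^sub>R (x - xstar)))\<^sup>2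
      - k * (norm v)\<^sup>2 - r * ((g - grad f x) \<bullet> v) - r * k * (g \<bullet> (x - xstar))
    \<le> C_ET f \<mu> L s a (x, v)"
proof -
  define y where "y = x - xstar"
  define h where "h = grad f x"
  have k: "k > 0" and kk: "k * k = \<mu>" using mu_pos by (simp_all add: k_def)
  have r: "r > 0" "r = 1 + k * sqrt s"
    using mu_pos assms(1) by (simp_all add: r_def rmus_def k_def real_sqrt_mult add_pos_pos)
  \<comment> \<open>Parallelogram bound. Its share \<open>k / 8\<close> of the squared norm of
    \<open>v\<close>, with \<open>k / 16 - k\<close>, makes the coefficient
    \<open>- 13 k / 16\<close> of \<open>C_ET\<close>.\<close>
  have "0 \<le> (v - (2 * k) *\<^sub>R y) \<bullet> (v - (2 * k) *\<^sub>R y)" by (rule inner_ge_zero)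
  then have "(norm (v + (2 * k) *\<^sub>R y))\<^sup>2 \<le> 2 * (norm v)\<^sup>2 + 8 * \<mu> * (norm y)\<^sup>2"
    unfolding power2_norm_eq_inner kk[symmetric] by (simp add: inner_commute algebra_simps)
  then have "k / 16 * (norm (v + (2 * k) *\<^sub>R y))\<^sup>2 \<le> k / 16 * (2 * (norm v)\<^sup>2 + 8 * \<mu> * (norm y)\<^sup>2)"
    using k by (intro mult_left_mono) auto
  then have 1: "k / 16 * (norm (v + (2 * k) *\<^sub>R y))\<^sup>2
      \<le> k / 8 * (norm v)\<^sup>2 + k * \<mu> / 2 * (norm y)\<^sup>2"
    by (simp add: algebra_simps)
  \<comment> \<open>The cross term of the squared norm of \<open>y + a v\<close> has no definite
    sign; trading \<open>\<mu> * norm y\<close> for \<open>norm h\<close> removes the unknown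
    \<open>xstar\<close> from it.\<close>
  have "\<mu> * - (y \<bullet> (a *\<^sub>R v)) \<le> \<mu> * (norm y * norm (a *\<^sub>R v))"
    using norm_cauchy_schwarz[of "- y" "a *\<^sub>R v"] mu_pos by (intro mult_left_mono) simp_all
  also have "\<dots> \<le> norm h * norm (a *\<^sub>R v)"
    using norm_grad_ge[of x] unfolding y_def h_def mult.assoc[symmetric]
    by (intro mult_right_mono) simp_all
  finally have "- (\<mu> * (y \<bullet> (a *\<^sub>R v))) \<le> norm h * norm (a *\<^sub>R v)" by simp
  moreover have "\<mu> / 2 * (norm (y + a *\<^sub>R v))\<^sup>2
      = \<mu> / 2 * (norm y)\<^sup>2 + \<mu> * (y \<bullet> (a *\<^sub>R v)) + \<mu> / 2 * (norm (a *\<^sub>R v))\<^sup>2"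
    unfolding power2_norm_eq_inner by (simp add: inner_commute algebra_simps)
  moreover have "f (x + a *\<^sub>R v) - g \<bullet> y - g \<bullet> (a *\<^sub>R v) + \<mu> / 2 * (norm (y + a *\<^sub>R v))\<^sup>2 \<le> f xstar"
    using strong_convexity[of "x + a *\<^sub>R v" xstar]
    by (simp add: g_def y_def inner_diff_right inner_add_right algebra_simps)
  ultimately have "- (g \<bullet> y) \<le> f xstar - f (x + a *\<^sub>R v) + g \<bullet> (a *\<^sub>R v)
      - \<mu> / 2 * (norm y)\<^sup>2 + norm h * norm (a *\<^sub>R v) - \<mu> / 2 * (norm (a *\<^sub>R v))\<^sup>2"
    by linarith
  then have 2: "r * k * - (g \<bullet> y) \<le> r * k * (f xstar - f (x + a *\<^sub>R v) + g \<bullet> (a *\<^sub>R v)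
      - \<mu> / 2 * (norm y)\<^sup>2 + norm h * norm (a *\<^sub>R v) - \<mu> / 2 * (norm (a *\<^sub>R v))\<^sup>2)"
    using r(1) k by (intro mult_left_mono) auto
  \<comment> \<open>The factor \<open>3 / 4\<close> is what remains of the gap: \<open>1 / 4\<close>
    comes from \<open>V_hb\<close>, and \<open>- 1\<close> from fact 2 after inserting
    \<open>f x\<close>.\<close>
  have 3: "3 / 4 * (r * k) * ((norm h)\<^sup>2 / (2 * L)) \<le> 3 / 4 * (r * k) * (f x - f xstar)"
    unfolding h_def using r(1) k by (intro mult_left_mono gap_ge_norm_grad) auto
  have "(norm h)\<^sup>2 \<le> (L * norm y)\<^sup>2"
    unfolding h_def y_def by (intro power_mono norm_grad_le) simp
  then have "(norm h)\<^sup>2 / L\<^sup>2 \<le> (norm y)\<^sup>2"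
    using L_pos by (simp add: field_simps)
  then have 4: "\<mu>\<^sup>2 * sqrt s / 2 * ((norm h)\<^sup>2 / L\<^sup>2) \<le> \<mu>\<^sup>2 * sqrt s / 2 * (norm y)\<^sup>2"
    using assms(1) by (intro mult_left_mono) auto
  \<comment> \<open>Facts 1 and 2 together leave \<open>- k * \<mu> * (r - 1) / 2\<close> in front
    of the squared norm of \<open>y\<close>, which explains the \<open>sqrt s\<close> term of
    \<open>C_ET\<close>.\<close>
  have "\<mu>\<^sup>2 * sqrt s = k * \<mu> * (r - 1)"
    by (simp add: r(2) power2_eq_square flip: kk)
  with 4 have 5: "\<mu>\<^sup>2 * sqrt s / 2 * ((norm h)\<^sup>2 / L\<^sup>2) \<le> k * \<mu> * (r - 1) / 2 * (norm y)\<^sup>2"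
    by simp
  have powr: "\<mu> powr (3/2) = k * \<mu>"
    using mu_pos powr_add[of \<mu> 1 "1/2"] by (simp add: powr_half_sqrt k_def)
  have "C_ET f \<mu> L s a (x, v) = - (13 * k / 16 * (norm v)\<^sup>2)
     - \<mu>\<^sup>2 * sqrt s / 2 * ((norm h)\<^sup>2 / L\<^sup>2)
     - 3 / 4 * (r * k) * ((norm h)\<^sup>2 / (2 * L))
     + r * k * (f x - f (x + a *\<^sub>R v) + norm h * norm (a *\<^sub>R v)
          - \<mu> / 2 * (norm (a *\<^sub>R v))\<^sup>2 + g \<bullet> (a *\<^sub>R v))
     - r * ((g - h) \<bullet> v)"
    unfolding C_ET_def Let_def prod.case g_def[symmetric] h_def[symmetric] r_def[symmetric]
      k_def[symmetric] powr
    by (simp add: field_simps)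
  with 1 2 3 5 show ?thesis
    unfolding y_def[symmetric] h_def[symmetric] by argo
qed

text \<open>Only the increments of \<open>grad f\<close> and \<open>f\<close> along \<open>v\<close>
  differ from the quadratic in \<open>t\<close>. The descent lemma sends its linear part to
  \<open>Bl_ST\<close> and its quadratic part to \<open>Bq_ST\<close>.\<close>

lemma bd_ET_le_bd_ST:
  assumes "s > 0" "t \<ge> 0"
  shows "bd_ET f \<mu> L s a (x, v) t \<le> bd_ST f \<mu> L s a (x, v) t"
proof -
  define k r g where "k = sqrt \<mu>" and "r = rmus \<mu> s" and "g = grad f (x + a *\<^sub>R v)"
  have k: "k > 0" and kk: "k * k = \<mu>" using mu_pos by (simp_all add: k_def)
  have r: "r > 0"
    using mu_pos assms(1) by (simp add: r_def rmus_def add_pos_pos)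
  have "r * ((grad f (x + t *\<^sub>R v) - grad f x) \<bullet> v) \<le> r * (L * t * (norm v)\<^sup>2)"
    using r lipschitz_grad_inner_scaleR_le[OF lipschitz_grad assms(2)]
    by (intro mult_left_mono) auto
  moreover have "k * r / 4 * f (x + t *\<^sub>R v)
      \<le> k * r / 4 * (f x + t * (grad f x \<bullet> v) + L / 2 * t\<^sup>2 * (norm v)\<^sup>2)"
    using k r descent_lemma[OF C1 lipschitz_grad assms(2)] by (intro mult_left_mono) auto
  ultimately show ?thesis
    unfolding bd_ET_def bd_ST_def A_ET_def A_ST_def B_ET_def Bl_ST_def Bq_ST_def C_ST_def
      Let_def prod.case r_def[symmetric] k_def[symmetric] g_def[symmetric]
    unfolding kk[symmetric]
    by (simp add: algebra_simps power2_eq_square inner_commute)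
qed

end

section \<open>Integration of the differential inequality\<close>

text \<open>A Gronwall argument: the weighted left-hand side of \<open>le\<close> is the derivative
  of \<open>exp (c * u) * V u\<close>, so the fundamental theorem of calculus supplies its
  integral.\<close>

lemma exp_weighted_increment_le_integral:
  fixes V V' b :: "real \<Rightarrow> real"
  assumes "t \<ge> 0"
    and deriv: "\<And>u. (V has_field_derivative V' u) (at u within {0..t})"
    and le: "\<And>u. 0 \<le> u \<Longrightarrow> u \<le> t \<Longrightarrow> V' u + c * V u \<le> b u"
    and int: "(\<lambda>u. exp (c * u) * b u) integrable_on {0..t}"
  shows "V t - exp (- c * t) * V 0 \<le> exp (- c * t) * integral {0..t} (\<lambda>u. exp (c * u) * b u)"
proof -
  have "((\<lambda>u. exp (c * u) * (V' u + c * V u)) has_integral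
      exp (c * t) * V t - exp (c * 0) * V 0) {0..t}"
  proof (rule fundamental_theorem_of_calculus[OF assms(1)])
    fix u
    show "((\<lambda>u. exp (c * u) * V u) has_vector_derivative exp (c * u) * (V' u + c * V u))
        (at u within {0..t})"
      unfolding has_real_derivative_iff_has_vector_derivative[symmetric]
      by (auto intro!: derivative_eq_intros deriv simp: algebra_simps)
  qed
  then have "exp (c * t) * V t - V 0 \<le> integral {0..t} (\<lambda>u. exp (c * u) * b u)"
    using has_integral_le[OF _ integrable_integral[OF int]] le by fastforce
  then have "exp (- c * t) * (exp (c * t) * V t - V 0)
      \<le> exp (- c * t) * integral {0..t} (\<lambda>u. exp (c * u) * b u)"
    by (intro mult_left_mono) auto
  then show ?thesis
    by (simp add: right_diff_distrib exp_add[symmetric] flip: mult.assoc)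
qed

theorem mainTheorem3:
  fixes f :: "real ^ 'n \<Rightarrow> real"
    and \<mu> L s a t :: real
    and xstar :: "real ^ 'n"
    and phat :: "(real ^ 'n) \<times> (real ^ 'n)"
    and p :: "real \<Rightarrow> (real ^ 'n) \<times> (real ^ 'n)"
  assumes "\<mu> > 0" and "L > 0" and "s > 0"
    and "C1 f"
    and "strongly_convex \<mu> f"
    and "L-lipschitz_on UNIV (grad f)"
    and "is_arg_min f (\<lambda>_. True) xstar"
    and "a \<ge> 0"
    and "p = zoh f \<mu> s a phat"
    and "t \<ge> 0"
  shows "V_hb f \<mu> s xstar (p t) - exp (- (sqrt \<mu> / 4) * t) * V_hb f \<mu> s xstar phat
           \<le> exp (- (sqrt \<mu> / 4) * t) * bp_ET f \<mu> L s a phat t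
       \<and> exp (- (sqrt \<mu> / 4) * t) * bp_ET f \<mu> L s a phat t
           \<le> exp (- (sqrt \<mu> / 4) * t) * bp_ST f \<mu> L s a phat t"
proof
  interpret smooth_strongly_convex f \<mu> L xstar
    using assms by unfold_locales (auto simp: is_arg_min_linorder)
  obtain x v where phat: "phat = (x, v)" by (cases phat)
  define g where "g = grad f (x + a *\<^sub>R v)"
  define V' where "V' u = A_ET f \<mu> s a (x, v) u - sqrt \<mu> * (norm v)\<^sup>2
    - rmus \<mu> s * ((g - grad f x) \<bullet> v) - rmus \<mu> s * sqrt \<mu> * (g \<bullet> (x - xstar))" for u
  have V'_le: "V' u + sqrt \<mu> / 4 * V_hb f \<mu> s xstar (p u) \<le> bd_ET f \<mu> L s a phat u"
    if "u \<ge> 0" for u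
  proof -
    \<comment> \<open>The cocoercivity defect carries the factor \<open>u\<close>, so dropping it
      uses \<open>u \<ge> 0\<close>.\<close>
    have "sqrt \<mu> * rmus \<mu> s / 4 * (u * sqrt \<mu>) * ((norm g)\<^sup>2 / L - g \<bullet> (x + a *\<^sub>R v - xstar)) \<le> 0"
      using that assms(1,3) cocoercive[of "x + a *\<^sub>R v"]
      by (intro mult_nonneg_nonpos) (auto simp: g_def rmus_def)
    then show ?thesis
      using constant_terms_le_C_ET[OF assms(3), of x v a]
      unfolding V'_def assms(9) phat bd_ET_def V_hb_zoh_eq g_def by linarith
  qed
  have "V_hb f \<mu> s xstar (p t) - exp (- (sqrt \<mu> / 4) * t) * V_hb f \<mu> s xstar (p 0)
      \<le> exp (- (sqrt \<mu> / 4) * t) * bp_ET f \<mu> L s a phat t"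
    unfolding bp_ET_def
  proof (rule exp_weighted_increment_le_integral[OF assms(10)])
    show "((\<lambda>u. V_hb f \<mu> s xstar (p u)) has_field_derivative V' u) (at u within {0..t})" for u
      unfolding assms(9) phat V'_def g_def by (rule V_hb_zoh_has_field_derivative)
  qed (use V'_le bp_integrable(1)[OF assms(4)] in auto)
  then show "V_hb f \<mu> s xstar (p t) - exp (- (sqrt \<mu> / 4) * t) * V_hb f \<mu> s xstar phat
           \<le> exp (- (sqrt \<mu> / 4) * t) * bp_ET f \<mu> L s a phat t"
    by (simp add: assms(9) zoh_0)
  show "exp (- (sqrt \<mu> / 4) * t) * bp_ET f \<mu> L s a phat t
           \<le> exp (- (sqrt \<mu> / 4) * t) * bp_ST f \<mu> L s a phat t"
    unfolding bp_ET_def bp_ST_def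
    using bd_ET_le_bd_ST[OF assms(3)] phat
    by (intro mult_left_mono integral_le bp_integrable assms(4)) auto
qed

end
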